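(* Let $P$ be a connection for an exposed equation $F_{i_1}$, and let $A\in\mathbb Z^{J\times K}$, $b\in\mathbb Z^J$ be the matrix and vector associated with $P$ (all as defined in the context). Consider the linear integer program $$\text{(ILP)}\quad \min \sum_{k=1}^K\nu_k\quad\text{such that } A\nu=b,\ \nu\in\mathbb N_0^K,$$ and the linear program $$\text{(LP)}\quad \min \sum_{k=1}^K\nu_k\quad\text{such that } A\nu=b,\ \nu\in\mathbb R^K,\ \nu\ge 0 .$$ 1. (LP) has a unique solution (minimizer). 2. (ILP) is solvable if and only if (LP) is solvable. In this case, the minimizing vector $\nu^\star$ of (LP) is the unique minimizer of (ILP).
   Context: Setting. A system of finitely many scalar equations in formal variables $\sigma_{k\tau}\xi^{(p)}$ is given, where $\xi\in\{x_1,\dots,x_n\}$, $k\in\{-1\}\cup\mathbb N_0$ is the order of shift ($(\sigma_{k\tau}f)(t)=f(t+k\tau)$) and $p\in\mathbb N_0$ is the order of differentiation. Group all appearing variables with the same $\xi$ and same shift $k$ into one equivalence class. Consider the bipartite graph $G$ whose vertices are the equations and those equivalence classes $(\xi,k)$ that are highest shifts (i.e. $k\ge 0$ and no variable $\sigma_{k'\tau}\xi^{(p)}$ with $k'>k$ appears in any equation), with an edge between an equation and a class if some element of the class appears in the equation. Let $\mathcal M$ be a matching in $G$ (a set of edges no two of which share a vertex). An exposed vertex is one in no matching edge. An alternating path is a path with distinct vertices, starting with a non-matching edge, with alternating non-matching and matching edges. Let $F_{i_1}$ be an exposed equation such that no alternating path starting in $F_{i_1}$ ends in an exposed variable class (no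 augmenting path). Let $C=\{F_{i_1},\dots,F_{i_K}\}$ be the set consisting of $F_{i_1}$ and all equations that can be reached from $F_{i_1}$ by an alternating path. Connection. A connection for $F_{i_1}$ is a set $P$ of alternating paths of the form $(F,v,F')$ with $F,F'\in C$, $\{v,F'\}\in\mathcal M$ and $\{F,v\}$ an edge of $G$ not in $\mathcal M$, such that every matching edge $\{v,F'\}\in\mathcal M$ with $F'\in C$ occurs in exactly one of the paths, and such that the paths are connected, i.e. the graph on the vertex set $C$ with an edge between $F$ and $F'$ for each $(F,v,F')\in P$ is connected. Linear system. Enumerate $P=\{(F_{i_{a_j}},v_j,F_{i_{c_j}})\mid j=1,\dots,J\}$ with $a_j,c_j\in\{1,\dots,K\}$. Let $\nu_k$ denote the number of times equation $F_{i_k}$ is to be differentiated. For each $j$ let $b_j\in\mathbb Z$ be the number of times that $F_{i_{a_j}}$ has to be differentiated more often than $F_{i_{c_j}}$ so that afterwards the highest derivative from the class $v_j$ appearing in both equations is the same; i.e. $b_j$ is the maximal order of differentiation among the elements of $v_j$ appearing in $F_{i_{c_j}}$ minus the maximal order of differentiation among the elements of $v_j$ appearing in $F_{i_{a_j}}$. The system $A\nu=b$ is $$\nu_{a_j}-\nu_{c_j}=b_j,\qquad j=1,\dots,J.$$ *)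

theory Defs
  imports "Jordan_Normal_Form.Matrix"
begin

text \<open>The formal variable \<open>\<sigma>\<^sub>k\<^sub>\<tau> \<xi>\<^sup>(\<^sup>p\<^sup>)\<close>: the \<open>k\<close>-fold shift of the \<open>p\<close>-th derivative of the unknown \<open>\<xi>\<close>.\<close>

datatype 'x fvar = FVar (unknown: 'x) (shift: int) (deriv_order: nat)

text \<open>Everything below depends on an equation only through the formal variables that appear in it.
  Equations are therefore labels, so that two equations with the same variables (or even two
  identical equations) remain distinct vertices.\<close>

record ('e, 'x) eq_system =
  equations :: "'e set"
  unknowns :: "'x set"
  appearing :: "'e \<Rightarrow> 'x fvar set"

definition eq_system :: "('e, 'x) eq_system \<Rightarrow> bool" where
  "eq_system S \<longleftrightarrow> finite (equations S) \<and> finite (unknowns S) \<and>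
     (\<forall>F \<in> equations S. finite (appearing S F) \<and>
        (\<forall>w \<in> appearing S F. unknown w \<in> unknowns S \<and> shift w \<ge> -1))"

text \<open>The equivalence class of all appearing variables with unknown \<open>\<xi>\<close> and shift \<open>k\<close> is
  represented by the pair \<open>(\<xi>, k)\<close>.\<close>

type_synonym 'x var_class = "'x \<times> int"

definition in_class :: "'x fvar \<Rightarrow> 'x var_class \<Rightarrow> bool" where
  "in_class w v \<longleftrightarrow> unknown w = fst v \<and> shift w = snd v"

definition class_appears :: "('e, 'x) eq_system \<Rightarrow> 'e \<Rightarrow> 'x var_class \<Rightarrow> bool" where
  "class_appears S F v \<longleftrightarrow> (\<exists>w \<in> appearing S F. in_class w v)"

definition highest_shifts :: "('e, 'x) eq_system \<Rightarrow> 'x var_class set" where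
  "highest_shifts S = {(\<xi>, k). k \<ge> 0 \<and> (\<exists>F \<in> equations S. class_appears S F (\<xi>, k)) \<and>
     \<not> (\<exists>k' > k. \<exists>F \<in> equations S. class_appears S F (\<xi>, k'))}"

type_synonym ('e, 'x) vertex = "'e + 'x var_class"

definition graph_vertices :: "('e, 'x) eq_system \<Rightarrow> ('e, 'x) vertex set" where
  "graph_vertices S = Inl ` equations S \<union> Inr ` highest_shifts S"

definition graph_edges :: "('e, 'x) eq_system \<Rightarrow> ('e, 'x) vertex set set" where
  "graph_edges S = {{Inl F, Inr v} | F v.
     F \<in> equations S \<and> v \<in> highest_shifts S \<and> class_appears S F v}"

definition matching :: "('e, 'x) eq_system \<Rightarrow> ('e, 'x) vertex set set \<Rightarrow> bool" where
  "matching S M \<longleftrightarrow> M \<subseteq> graph_edges S \<and> (\<forall>d \<in> M. \<forall>e \<in> M. d \<noteq> e \<longrightarrow> d \<inter> e = {})"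

definition exposed ::
  "('e, 'x) eq_system \<Rightarrow> ('e, 'x) vertex set set \<Rightarrow> ('e, 'x) vertex \<Rightarrow> bool" where
  "exposed S M u \<longleftrightarrow> u \<in> graph_vertices S \<and> \<not> (\<exists>e \<in> M. u \<in> e)"

text \<open>A path is the list of its vertices. Edge number \<open>i\<close> joins \<open>p ! i\<close> and \<open>p ! Suc i\<close>, so the first
  edge, which must not be in the matching, has the even number 0.\<close>

definition path_edges :: "'a list \<Rightarrow> 'a set set" where
  "path_edges p = {{p ! i, p ! Suc i} | i. Suc i < length p}"

definition alternating_path ::
  "('e, 'x) eq_system \<Rightarrow> ('e, 'x) vertex set set \<Rightarrow> ('e, 'x) vertex list \<Rightarrow> bool" where
  "alternating_path S M p \<longleftrightarrow> length p \<ge> 2 \<and> distinct p \<and> path_edges p \<subseteq> graph_edges S \<and>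
     (\<forall>i. Suc i < length p \<longrightarrow> ({p ! i, p ! Suc i} \<in> M \<longleftrightarrow> odd i))"

definition no_augmenting_path ::
  "('e, 'x) eq_system \<Rightarrow> ('e, 'x) vertex set set \<Rightarrow> 'e \<Rightarrow> bool" where
  "no_augmenting_path S M F\<^sub>1 \<longleftrightarrow>
     \<not> (\<exists>p v. alternating_path S M p \<and> hd p = Inl F\<^sub>1 \<and> last p = Inr v \<and> exposed S M (Inr v))"

definition reachable_equations ::
  "('e, 'x) eq_system \<Rightarrow> ('e, 'x) vertex set set \<Rightarrow> 'e \<Rightarrow> 'e set" where
  "reachable_equations S M F\<^sub>1 =
     {F\<^sub>1} \<union> {F. \<exists>p. alternating_path S M p \<and> hd p = Inl F\<^sub>1 \<and> last p = Inl F}"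

text \<open>The triple \<open>(F, v, F')\<close> stands for the path with vertices \<open>F\<close>, \<open>v\<close>, \<open>F'\<close>.\<close>

fun triple_path :: "'e \<times> 'x var_class \<times> 'e \<Rightarrow> ('e, 'x) vertex list" where
  "triple_path (F, v, F') = [Inl F, Inr v, Inl F']"

definition connected_by :: "'e set \<Rightarrow> ('e \<times> 'x var_class \<times> 'e) set \<Rightarrow> bool" where
  "connected_by C P \<longleftrightarrow> (\<forall>F \<in> C. \<forall>F' \<in> C.
     (F, F') \<in> {(G, G'). \<exists>v. (G, v, G') \<in> P \<or> (G', v, G) \<in> P}\<^sup>*)"

definition connection ::
  "('e, 'x) eq_system \<Rightarrow> ('e, 'x) vertex set set \<Rightarrow> 'e \<Rightarrow> ('e \<times> 'x var_class \<times> 'e) set \<Rightarrow> bool" where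
  "connection S M F\<^sub>1 P \<longleftrightarrow>
     (let C = reachable_equations S M F\<^sub>1 in
       (\<forall>(F, v, F') \<in> P. alternating_path S M (triple_path (F, v, F')) \<and> F \<in> C \<and> F' \<in> C \<and>
          {Inr v, Inl F'} \<in> M \<and> {Inl F, Inr v} \<in> graph_edges S - M) \<and>
       (\<forall>v F'. {Inr v, Inl F'} \<in> M \<and> F' \<in> C \<longrightarrow>
          (\<exists>!q. q \<in> P \<and> {Inr v, Inl F'} \<in> path_edges (triple_path q))) \<and>
       connected_by C P)"

text \<open>Only meaningful if the class \<open>v\<close> appears in \<open>F\<close>; otherwise the maximum is over the empty set.\<close>

definition max_deriv :: "('e, 'x) eq_system \<Rightarrow> 'e \<Rightarrow> 'x var_class \<Rightarrow> nat" where
  "max_deriv S F v = Max (deriv_order ` {w \<in> appearing S F. in_class w v})"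

text \<open>The lists \<open>Fs\<close> and \<open>Ps\<close> enumerate \<open>C\<close> and \<open>P\<close>, with indices starting from 0 instead of 1.
  Row \<open>j\<close> is the left-hand side of \<open>\<nu>\<^sub>a - \<nu>\<^sub>c = b\<^sub>j\<close>, where \<open>Ps ! j = (Fs ! a, v, Fs ! c)\<close>.\<close>

definition connection_matrix :: "'e list \<Rightarrow> ('e \<times> 'x var_class \<times> 'e) list \<Rightarrow> int mat" where
  "connection_matrix Fs Ps = mat (length Ps) (length Fs) (\<lambda>(j, k). case Ps ! j of (F, v, F') \<Rightarrow>
     (if Fs ! k = F then 1 else 0) - (if Fs ! k = F' then 1 else 0))"

definition connection_vector ::
  "('e, 'x) eq_system \<Rightarrow> ('e \<times> 'x var_class \<times> 'e) list \<Rightarrow> int vec" where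
  "connection_vector S Ps = vec (length Ps) (\<lambda>j. case Ps ! j of (F, v, F') \<Rightarrow>
     int (max_deriv S F' v) - int (max_deriv S F v))"

definition objective :: "real vec \<Rightarrow> real" where
  "objective \<nu> = (\<Sum>k < dim_vec \<nu>. \<nu> $ k)"

definition lp_feasible :: "int mat \<Rightarrow> int vec \<Rightarrow> real vec \<Rightarrow> bool" where
  "lp_feasible A b \<nu> \<longleftrightarrow> \<nu> \<in> carrier_vec (dim_col A) \<and>
     map_mat real_of_int A *\<^sub>v \<nu> = map_vec real_of_int b \<and> (\<forall>k < dim_col A. \<nu> $ k \<ge> 0)"

text \<open>\<open>\<nat>\<close> is the set of natural numbers, including 0, inside the reals.\<close>

definition ilp_feasible :: "int mat \<Rightarrow> int vec \<Rightarrow> real vec \<Rightarrow> bool" where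
  "ilp_feasible A b \<nu> \<longleftrightarrow> \<nu> \<in> carrier_vec (dim_col A) \<and>
     map_mat real_of_int A *\<^sub>v \<nu> = map_vec real_of_int b \<and> (\<forall>k < dim_col A. \<nu> $ k \<in> \<nat>)"

definition lp_minimizer :: "int mat \<Rightarrow> int vec \<Rightarrow> real vec \<Rightarrow> bool" where
  "lp_minimizer A b \<nu> \<longleftrightarrow> is_arg_min objective (lp_feasible A b) \<nu>"

definition ilp_minimizer :: "int mat \<Rightarrow> int vec \<Rightarrow> real vec \<Rightarrow> bool" where
  "ilp_minimizer A b \<nu> \<longleftrightarrow> is_arg_min objective (ilp_feasible A b) \<nu>"

end

theory Submission
  imports Defs
begin

text \<open>In a connection every equation of \<open>C\<close> is the third entry of at most one triple, and the exposed
  equation of none. Being connected, the connection is therefore a tree rooted at the exposed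
  equation, so \<open>A\<nu> = b\<close> is solved by an integral potential, and all real solutions arise from it by
  adding a constant to all entries. On this line the objective is strictly increasing, and the
  smallest nonnegative solution, whose least entry is 0, is integral.\<close>

section \<open>Potentials on a rooted tree\<close>

text \<open>A relation instead of a recursive function, because the triples come with no
  well-founded order to recurse on. Triples point from parent to child, and each step away from the
  root \<open>r\<close> subtracts the weight of the triple used.\<close>

inductive potential ::
  "('v \<times> 'x var_class \<times> 'v) set \<Rightarrow>
    ('v \<times> 'x var_class \<times> 'v \<Rightarrow> int) \<Rightarrow> 'v \<Rightarrow> 'v \<Rightarrow> int \<Rightarrow> bool"
  for E w r where
  root: "potential E w r r 0"
| step: "potential E w r u n \<Longrightarrow> (u, l, v) \<in> E \<Longrightarrow> potential E w r v (n - w (u, l, v))"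

text \<open>The last rule of a derivation is forced: nothing enters the root, and any other vertex
  has a single incoming triple. Hence two derivations for the same vertex agree step by
  step.\<close>

lemma potential_unique:
  assumes root: "\<And>u l. (u, l, r) \<notin> E"
    and parent: "\<And>u l u' l' v. (u, l, v) \<in> E \<Longrightarrow> (u', l', v) \<in> E \<Longrightarrow> u = u' \<and> l = l'"
    and "potential E w r v n" "potential E w r v m"
  shows "n = m"
  using assms(3,4)
proof (induction arbitrary: m)
  case root
  then show ?case
    by cases (use assms(1) in auto)
next
  case (step u n l v)
  from step.prems show ?case
  proof cases
    case root
    then show ?thesis using step.hyps assms(1) by blast
  next
    case (step u' n' l')
    then show ?thesis using parent[OF \<open>(u, l, v) \<in> E\<close>] \<open>\<And>m. potential E w r u m \<Longrightarrow> n = m\<close>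
      by blast
  qed
qed

text \<open>Every vertex of \<open>C\<close> gets a value by following a walk from the root, and
  uniqueness turns the relation into a function. Connectedness ignores directions, so the walk may
  also use triples backwards.\<close>

lemma rooted_tree_potential:
  fixes w :: "'v \<times> 'x var_class \<times> 'v \<Rightarrow> int"
  assumes root: "\<And>u l. (u, l, r) \<notin> E"
    and parent: "\<And>u l u' l' v. (u, l, v) \<in> E \<Longrightarrow> (u', l', v) \<in> E \<Longrightarrow> u = u' \<and> l = l'"
    and conn: "connected_by C E" and "r \<in> C"
  obtains h where "\<And>u l v. (u, l, v) \<in> E \<Longrightarrow> u \<in> C \<Longrightarrow> h u - h v = w (u, l, v)"
proof -
  have ex: "\<exists>n. potential E w r v n" if "v \<in> C" for v
  proof -
    have "(r, v) \<in> {(G, G'). \<exists>l. (G, l, G') \<in> E \<or> (G', l, G) \<in> E}\<^sup>*"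
      using conn \<open>r \<in> C\<close> that unfolding connected_by_def by blast
    then show ?thesis
    proof induction
      case base
      show ?case by (rule exI, rule potential.root)
    next
      case (step y z)
      then obtain n l where n: "potential E w r y n"
        and l: "(y, l, z) \<in> E \<or> (z, l, y) \<in> E" by blast
      from l show ?case
      proof
        assume "(y, l, z) \<in> E"
        with n show ?thesis by (intro exI) (rule potential.step)
      next
        \<comment> \<open>Against the direction: \<open>y\<close> is not the root, so its derivation
          ended with its only incoming triple, which is this one; the derivation therefore already
          contains a value for \<open>z\<close>.\<close>
        assume zy: "(z, l, y) \<in> E"
        from n show ?thesis
        proof cases
          case root
          with zy assms(1) show ?thesis by blast
        next
          case (step u m l')
          with parent[OF zy step(3)] show ?thesis by blast
        qed
      qed
    qed
  qed
  define h where "h v = (THE n. potential E w r v n)" for v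
  have h: "h v = n" if "potential E w r v n" for v n
    unfolding h_def using that by (intro the_equality potential_unique[OF root parent])
  show thesis
  proof
    fix u l v assume E: "(u, l, v) \<in> E" and "u \<in> C"
    then obtain n where n: "potential E w r u n" using ex by blast
    show "h u - h v = w (u, l, v)"
      using h[OF n] h[OF potential.step[OF n E]] by simp
  qed
qed

text \<open>Meant for the difference between a solution and the potential; it leaves one additive
  constant as the only freedom.\<close>

lemma connected_by_constant:
  assumes "connected_by C E" "u \<in> C" "v \<in> C"
    and edge: "\<And>x l y. (x, l, y) \<in> E \<Longrightarrow> f x = f y"
  shows "f u = f v"
proof -
  have "(u, v) \<in> {(G, G'). \<exists>l. (G, l, G') \<in> E \<or> (G', l, G) \<in> E}\<^sup>*"
    using assms unfolding connected_by_def by blast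
  then show ?thesis
    by induction (auto dest: edge)
qed

section \<open>Connections as rooted trees\<close>

lemma connectionD:
  assumes "connection S M F\<^sub>1 P" "(F, v, G) \<in> P"
  shows "F \<in> reachable_equations S M F\<^sub>1" "G \<in> reachable_equations S M F\<^sub>1"
    "{Inr v, Inl G} \<in> M"
  using assms by (auto simp: connection_def Let_def dest!: bspec[where x = "(F, v, G)"])

text \<open>Each triple ends with a matching edge at its third entry, which an exposed equation
  cannot have.\<close>

lemma connection_no_edge_into_exposed:
  assumes "exposed S M (Inl F\<^sub>1)" "connection S M F\<^sub>1 P"
  shows "(F, v, F\<^sub>1) \<notin> P"
  using connectionD(3)[OF assms(2), of F v F\<^sub>1] assms(1) by (auto simp: exposed_def)

text \<open>The matching allows only one matching edge at \<open>G\<close>, which fixes the class;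
  the requirement that this edge lies on exactly one path then fixes the first equation.\<close>

lemma connection_unique_parent:
  assumes "matching S M" "connection S M F\<^sub>1 P"
    and q: "(F, v, G) \<in> P" "(F', v', G) \<in> P"
  shows "F = F' \<and> v = v'"
proof -
  have M: "{Inr v, Inl G} \<in> M" "{Inr v', Inl G} \<in> M" "G \<in> reachable_equations S M F\<^sub>1"
    using q by (simp_all add: connectionD[OF assms(2)])
  have disj: "d \<inter> e = {}" if "d \<in> M" "e \<in> M" "d \<noteq> e" for d e
    using assms(1) that by (simp add: matching_def)
  have "{Inr v, Inl G} = ({Inr v', Inl G} :: ('a, 'b) vertex set)"
    using disj[OF M(1,2)] by auto
  then have v: "v' = v" by (auto simp: doubleton_eq_iff)
  have "\<exists>!q. q \<in> P \<and> {Inr v, Inl G} \<in> path_edges (triple_path q)"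
    using assms(2) M unfolding connection_def Let_def by blast
  \<comment> \<open>Edges are numbered from 0, so the matching edge of a triple has index 1.\<close>
  moreover have "{Inr v, Inl G} \<in> path_edges (triple_path (H, v, G))" for H :: 'a
    unfolding path_edges_def by (auto intro!: exI[of _ 1])
  ultimately have "(F, v, G) = (F', v, G)"
    using q unfolding v by blast
  with v show ?thesis by simp
qed

section \<open>Solutions of the linear system\<close>

text \<open>Distinctness of \<open>Fs\<close> turns the comparisons of equations in the matrix into
  comparisons of indices, so the row is a difference of two unit vectors.\<close>

lemma connection_matrix_mult_index:
  assumes "distinct Fs" "a < length Fs" "c < length Fs" "j < length Ps"
    and "Ps ! j = (Fs ! a, v, Fs ! c)" "\<nu> \<in> carrier_vec (length Fs)"
  shows "(map_mat real_of_int (connection_matrix Fs Ps) *\<^sub>v \<nu>) $ j = \<nu> $ a - \<nu> $ c"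
proof -
  have "(map_mat real_of_int (connection_matrix Fs Ps) *\<^sub>v \<nu>) $ j =
      (\<Sum>k = 0..<length Fs. ((if k = a then 1 else 0) - (if k = c then 1 else 0)) * \<nu> $ k)"
    using assms by (auto simp: connection_matrix_def scalar_prod_def nth_eq_iff_index_eq
      intro!: sum.cong)
  also have "\<dots> = (\<Sum>k = 0..<length Fs. if k = a then \<nu> $ k else 0) -
      (\<Sum>k = 0..<length Fs. if k = c then \<nu> $ k else 0)"
    unfolding sum_subtractf[symmetric] by (intro sum.cong) auto
  also have "\<dots> = \<nu> $ a - \<nu> $ c"
    using assms by (simp add: sum.delta)
  finally show ?thesis .
qed

text \<open>Subtracting the particular solution \<open>h\<close> makes the system homogeneous: each
  row says that \<open>\<nu> - h\<close> agrees at both ends of a triple, and connectedness spreads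
  this over all of \<open>Fs\<close>.\<close>

lemma connection_system_iff:
  assumes "distinct Fs" "Fs \<noteq> []" "connected_by (set Fs) (set Ps)"
    and mem: "\<And>F v G. (F, v, G) \<in> set Ps \<Longrightarrow> F \<in> set Fs \<and> G \<in> set Fs"
    and h: "\<And>F v G. (F, v, G) \<in> set Ps \<Longrightarrow>
      h F - h G = int (max_deriv S G v) - int (max_deriv S F v)"
    and \<nu>: "\<nu> \<in> carrier_vec (length Fs)"
  shows "map_mat real_of_int (connection_matrix Fs Ps) *\<^sub>v \<nu> =
      map_vec real_of_int (connection_vector S Ps) \<longleftrightarrow>
    (\<exists>c. \<forall>k < length Fs. \<nu> $ k = real_of_int (h (Fs ! k)) + c)"
    (is "?L = ?R \<longleftrightarrow> ?Q")
proof -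
  have dims: "dim_vec ?L = length Ps" "dim_vec ?R = length Ps"
    by (simp_all add: connection_matrix_def connection_vector_def)
  have row: "?L $ j = ?R $ j \<longleftrightarrow>
      \<nu> $ a - real_of_int (h (Fs ! a)) = \<nu> $ c - real_of_int (h (Fs ! c))"
    if "j < length Ps" "Ps ! j = (Fs ! a, v, Fs ! c)" "a < length Fs" "c < length Fs" for j a v c
  proof -
    have "(Fs ! a, v, Fs ! c) \<in> set Ps" using that nth_mem by metis
    then have "?R $ j = real_of_int (h (Fs ! a) - h (Fs ! c))"
      using that h by (simp add: connection_vector_def)
    then show ?thesis
      using connection_matrix_mult_index[OF assms(1) that(3,4,1,2) \<nu>] by auto
  qed
  show ?thesis
  proof
    assume eq: "?L = ?R"
    \<comment> \<open>\<open>idx\<close> inverts the enumeration \<open>Fs\<close>, so that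
      \<open>\<nu>\<close> can be read as a function on equations, as the connectedness argument
      requires.\<close>
    define idx where "idx F = (SOME k. k < length Fs \<and> Fs ! k = F)" for F
    have idx: "idx F < length Fs \<and> Fs ! idx F = F" if "F \<in> set Fs" for F
      using that someI_ex[of "\<lambda>k. k < length Fs \<and> Fs ! k = F"]
      by (simp add: idx_def in_set_conv_nth)
    have idx_nth: "idx (Fs ! k) = k" if "k < length Fs" for k
      using idx[OF nth_mem[OF that]] that assms(1) nth_eq_iff_index_eq by blast
    define f where "f F = \<nu> $ idx F - real_of_int (h F)" for F
    have edge: "f F = f G" if P: "(F, v, G) \<in> set Ps" for F v G
    proof -
      obtain j where "j < length Ps" "Ps ! j = (F, v, G)"
        using P by (auto simp: in_set_conv_nth)
      then show ?thesis
        using row[of j "idx F" v "idx G"] eq idx mem[OF P] by (simp add: f_def)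
    qed
    have "f (Fs ! k) = f (hd Fs)" if "k < length Fs" for k
      by (rule connected_by_constant[OF assms(3)]) (use that assms(2) edge in auto)
    then show ?Q
      by (intro exI[of _ "f (hd Fs)"]) (auto simp: f_def idx_nth algebra_simps)
  next
    assume ?Q
    then obtain c where c: "\<And>k. k < length Fs \<Longrightarrow> \<nu> $ k = real_of_int (h (Fs ! k)) + c" by blast
    show "?L = ?R"
    proof (rule eq_vecI)
      fix j assume "j < dim_vec ?R"
      then have j: "j < length Ps" using dims by simp
      obtain F v G where q: "Ps ! j = (F, v, G)" by (cases "Ps ! j")
      then have "F \<in> set Fs" "G \<in> set Fs" using mem j nth_mem by metis+
      then obtain a d where "a < length Fs" "Fs ! a = F" "d < length Fs" "Fs ! d = G"
        by (metis in_set_conv_nth)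
      then show "?L $ j = ?R $ j" using row[OF j, of a v d] q c by simp
    qed (use dims in simp)
  qed
qed

section \<open>Minimizing over the solution line\<close>

text \<open>The nonnegative translates of \<open>h\<close> form a ray on which the sum of entries
  has slope \<open>n > 0\<close>, so its end point is the strict minimizer. As \<open>h\<close> is
  integral, this point is also feasible for the integer program.\<close>

lemma minimizers_of_translates:
  fixes h :: "nat \<Rightarrow> int"
  assumes n: "n > 0" "dim_col A = n"
    and sys: "\<And>\<nu>. \<nu> \<in> carrier_vec n \<Longrightarrow>
      map_mat real_of_int A *\<^sub>v \<nu> = map_vec real_of_int b \<longleftrightarrow>
      (\<exists>c. \<forall>k < n. \<nu> $ k = real_of_int (h k) + c)"
  obtains \<nu> where "\<And>\<mu>. lp_minimizer A b \<mu> \<longleftrightarrow> \<mu> = \<nu>" "\<And>\<mu>. ilp_minimizer A b \<mu> \<longleftrightarrow> \<mu> = \<nu>"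
proof -
  \<comment> \<open>The shift by \<open>- m\<close> is the least one that keeps all entries
    nonnegative.\<close>
  define m where "m = Min (h ` {..<n})"
  have "m \<in> h ` {..<n}" unfolding m_def using n by (intro Min_in) auto
  then obtain i where i: "i < n" "m = h i" by blast
  have m_le: "m \<le> h k" if "k < n" for k
    unfolding m_def using that by (intro Min_le) auto
  define \<nu> where "\<nu> = vec n (\<lambda>k. real_of_int (h k - m))"
  have "real_of_int (h k - m) \<in> \<nat>" if "k < n" for k
    using m_le[OF that] by (metis diff_ge_0_iff_ge of_int_of_nat_eq of_nat_in_Nats nonneg_int_cases)
  moreover have "\<exists>c. \<forall>k < n. \<nu> $ k = real_of_int (h k) + c"
    by (intro exI[of _ "- real_of_int m"]) (simp add: \<nu>_def)
  moreover have "\<nu> \<in> carrier_vec n" by (simp add: \<nu>_def)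
  ultimately have ilp: "ilp_feasible A b \<nu>"
    unfolding ilp_feasible_def using sys n by (simp add: \<nu>_def)
  have relax: "lp_feasible A b \<mu>" if "ilp_feasible A b \<mu>" for \<mu>
    using that unfolding ilp_feasible_def lp_feasible_def by (auto simp: Nats_def)
  have less: "objective \<nu> < objective \<mu>" if lp: "lp_feasible A b \<mu>" and "\<mu> \<noteq> \<nu>" for \<mu>
  proof -
    have \<mu>: "\<mu> \<in> carrier_vec n" and nonneg: "\<forall>k < n. \<mu> $ k \<ge> 0"
      using lp n unfolding lp_feasible_def by auto
    obtain c where c: "\<And>k. k < n \<Longrightarrow> \<mu> $ k = real_of_int (h k) + c"
      using lp \<mu> sys unfolding lp_feasible_def by blast
    \<comment> \<open>The entry \<open>i\<close>, where \<open>h\<close> attains its minimum, gives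
      the tightest bound on \<open>c\<close>. By the choice of \<open>\<nu>\<close>, the sum
      \<open>c + m\<close> is the amount by which each entry of \<open>\<mu>\<close> exceeds that of
      \<open>\<nu>\<close>.\<close>
    have "c + m \<ge> 0" using nonneg c[of i] i by fastforce
    moreover have "c + m \<noteq> 0"
    proof
      assume "c + m = 0"
      then have "c = - real_of_int m" by simp
      then have "\<mu> = \<nu>" using \<mu> c by (intro eq_vecI) (auto simp: \<nu>_def)
      with \<open>\<mu> \<noteq> \<nu>\<close> show False by simp
    qed
    ultimately have "c + m > 0" by simp
    then have "(\<Sum>k < n. \<nu> $ k) < (\<Sum>k < n. \<mu> $ k)"
      using n by (intro sum_strict_mono) (auto simp: \<nu>_def c)
    then show ?thesis using \<mu> by (simp add: objective_def \<nu>_def)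
  qed
  \<comment> \<open>A strict minimizer over the larger feasible set stays the only minimizer over
    any subset containing it. Taking both feasible sets for \<open>Q\<close> settles both
    programs.\<close>
  have strict: "is_arg_min objective Q \<mu> \<longleftrightarrow> \<mu> = \<nu>"
    if "Q \<nu>" "\<And>\<mu>. Q \<mu> \<Longrightarrow> lp_feasible A b \<mu>" for Q \<mu>
    using that less unfolding is_arg_min_def by (metis less_asym less_irrefl)
  show thesis
    by (rule that[of \<nu>]; unfold lp_minimizer_def ilp_minimizer_def; rule strict)
      (use ilp relax in auto)
qed

theorem theorem3p14:
  fixes S :: "('e, 'x) eq_system"
    and M :: "('e, 'x) vertex set set"
    and F\<^sub>1 :: 'e
    and P :: "('e \<times> 'x var_class \<times> 'e) set"
    and Fs :: "'e list"
    and Ps :: "('e \<times> 'x var_class \<times> 'e) list"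
    and A :: "int mat" and b :: "int vec"
  assumes "eq_system S"
    and "matching S M"
    and "F\<^sub>1 \<in> equations S" and "exposed S M (Inl F\<^sub>1)"
    and "no_augmenting_path S M F\<^sub>1"
    and "connection S M F\<^sub>1 P"
    and "distinct Fs" and "set Fs = reachable_equations S M F\<^sub>1" and "Fs ! 0 = F\<^sub>1"
    and "distinct Ps" and "set Ps = P"
    and "A = connection_matrix Fs Ps" and "b = connection_vector S Ps"
  shows "(\<exists>!\<nu>. lp_minimizer A b \<nu>) \<and>
         ((\<exists>\<nu>. ilp_minimizer A b \<nu>) \<longleftrightarrow> (\<exists>\<nu>. lp_minimizer A b \<nu>)) \<and>
         (\<forall>\<nu>. lp_minimizer A b \<nu> \<longrightarrow>
            ilp_minimizer A b \<nu> \<and> (\<forall>\<mu>. ilp_minimizer A b \<mu> \<longrightarrow> \<mu> = \<nu>))"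
proof -
  have mem: "F \<in> set Fs \<and> G \<in> set Fs" if "(F, v, G) \<in> set Ps" for F v G
    unfolding assms(8) using connectionD(1,2)[OF assms(6)] that assms(11) by simp
  have conn: "connected_by (set Fs) (set Ps)"
    using assms(6) by (simp add: connection_def Let_def assms(8,11))
  have F1: "F\<^sub>1 \<in> set Fs" using assms(8) by (simp add: reachable_equations_def)
  have root: "(F, v, F\<^sub>1) \<notin> set Ps" for F v
    unfolding assms(11) by (rule connection_no_edge_into_exposed[OF assms(4,6)])
  have parent: "F = F' \<and> v = v'" if "(F, v, G) \<in> set Ps" "(F', v', G) \<in> set Ps" for F v F' v' G
    using that unfolding assms(11) by (rule connection_unique_parent[OF assms(2,6)])
  \<comment> \<open>The weight of a triple is its entry in the right-hand side \<open>b\<close>, so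
    a potential for \<open>w\<close> solves the system.\<close>
  define w where "w = (\<lambda>(F, v, G). int (max_deriv S G v) - int (max_deriv S F v))"
  obtain h where "\<And>F v G. (F, v, G) \<in> set Ps \<Longrightarrow> F \<in> set Fs \<Longrightarrow> h F - h G = w (F, v, G)"
    by (rule rooted_tree_potential[OF root _ conn F1, where w = w]) (erule parent, assumption, blast)
  then have h: "h F - h G = int (max_deriv S G v) - int (max_deriv S F v)"
    if "(F, v, G) \<in> set Ps" for F v G
    using that mem[OF that] by (simp add: w_def)
  have ne: "Fs \<noteq> []" using F1 by auto
  have sys: "map_mat real_of_int A *\<^sub>v \<nu> = map_vec real_of_int b \<longleftrightarrow>
      (\<exists>c. \<forall>k < length Fs. \<nu> $ k = real_of_int (h (Fs ! k)) + c)"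
    if "\<nu> \<in> carrier_vec (length Fs)" for \<nu>
    unfolding assms(12,13) by (rule connection_system_iff[OF assms(7) ne conn mem h that])
  have "length Fs > 0" "dim_col A = length Fs"
    using ne assms(12) by (simp_all add: connection_matrix_def)
  \<comment> \<open>One vector is the only minimizer of both programs, which yields all three claims
    at once.\<close>
  then obtain \<nu> where "\<And>\<mu>. lp_minimizer A b \<mu> \<longleftrightarrow> \<mu> = \<nu>"
      "\<And>\<mu>. ilp_minimizer A b \<mu> \<longleftrightarrow> \<mu> = \<nu>"
    using minimizers_of_translates[OF _ _ sys] by blast
  then show ?thesis by simp
qed

end
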